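(* Let $M_1$ be a spacelike non-cylindrical ruled surface in $\mathbb{R}_1^3$ (spacelike base curve and spacelike rulings), parametrized by $\tilde\varphi_1(u,v)=\vec\beta_1(u)+v\,\vec e_1(u)$, where $\vec\beta_1$ is the striction curve and $\vec e_1$ the unit director curve, under the standing assumptions on $\vec e_1$ and $\vec\beta_1$ given in the context. Let $P=P(u)$ be its distribution parameter. Then the Gaussian curvature $K=K(u,v)$ of $M_1$ is given in terms of $P$ by $$K=-\frac{P^2}{\left(P^2-v^2\right)^2},\qquad\text{where } |v|<|P|.$$
   Context: $\mathbb{R}_1^3$ is $\mathbb{R}^3$ with the Lorentz metric $\langle x,y\rangle=g(x,y)=x_1y_1+x_2y_2-x_3y_3$, and $\|\vec v\|=\sqrt{|\langle \vec v,\vec v\rangle|}$. A vector $\vec v$ is spacelike if $\langle \vec v,\vec v\rangle>0$ or $\vec v=0$, timelike if $\langle \vec v,\vec v\rangle<0$, and null if $\langle \vec v,\vec v\rangle=0$ with $\vec v\neq0$. A curve is spacelike (timelike) if all its velocity vectors are. The Lorentzian product is $\vec v\wedge\vec w=(v_3w_2-v_2w_3,\;v_1w_3-v_3w_1,\;v_1w_2-v_2w_1)$. Ruled surface: a surface parametrized by $\varphi(u,v)=\vec\alpha(u)+v\,\vec\gamma(u)$, $(u,v)\in I\times\mathbb{R}$, with $\vec\alpha,\vec\gamma$ smooth curves in $\mathbb{R}_1^3$ and $\vec\alpha'$ nowhere zero. It is non-cylindrical if $\vec\gamma\wedge\vec\gamma'$ is nowhere zero. Its striction curve is $\vec\beta=\vec\alpha-\frac{\langle\vec\alpha',\vec\gamma'\rangle}{\langle\vec\gamma',\vec\gamma'\rangle}\vec\gamma$.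 A non-cylindrical ruled surface is reparametrized as $\tilde\varphi(u,v)=\vec\beta(u)+v\,\vec e(u)$ with $\|\vec e\|=1$, $\langle\vec\beta',\vec e'\rangle=0$ and $\vec\beta$ the striction curve. Standing assumptions for $M_1$: $\vec e_1$ is spacelike with $\langle\vec e_1,\vec e_1\rangle=1$; with $\vec n_1=\vec e_1'/\|\vec e_1'\|$ and $\vec\xi_1=\vec e_1\wedge\vec e_1'/\|\vec e_1\wedge\vec e_1'\|$, the frame $\{\vec e_1,\vec n_1,\vec\xi_1\}$ is orthonormal of type {space, time, space}, i.e. $\langle\vec e_1,\vec e_1\rangle=1$, $\langle\vec n_1,\vec n_1\rangle=-1$, $\langle\vec\xi_1,\vec\xi_1\rangle=1$ and the vectors are mutually orthogonal (in particular $\vec e_1'$ is timelike). The striction curve is spacelike and satisfies $\vec\beta_1'=\cos\sigma_1\,\vec e_1+\sin\sigma_1\,\vec\xi_1$ for a smooth function $\sigma_1=\sigma_1(u)$. Distribution parameter: $P=\dfrac{\det(\vec\beta',\vec e,\vec e')}{\langle\vec e',\vec e'\rangle}$ (a function of $u$), with $\det$ the usual determinant in coordinates. Gaussian curvature (the sign convention used here): $K=\dfrac{LM-N^2}{EG-F^2}$, where $E=\langle\tilde\varphi_u,\tilde\varphi_u\rangle$, $F=\langle\tilde\varphi_u,\tilde\varphi_v\rangle$, $G=\langle\tilde\varphi_v,\tilde\varphi_v\rangle$, $L=\langle\tilde\varphi_{uu},\vec\eta\rangle$, $N=\langle\tilde\varphi_{uv},\vec\eta\rangle$, $M=\langle\tilde\varphi_{vv},\vec\eta\rangle$,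 and $\vec\eta=\dfrac{\tilde\varphi_u\wedge\tilde\varphi_v}{\|\tilde\varphi_u\wedge\tilde\varphi_v\|}$ is the unit normal. The surface being spacelike means that $\vec\eta$ is timelike; this corresponds to the condition $|v|<|P(u)|$. *)

theory Defs
  imports "HOL-Analysis.Analysis"
begin

definition lor :: "real^3 \<Rightarrow> real^3 \<Rightarrow> real" where
  "lor x y = x $ 1 * y $ 1 + x $ 2 * y $ 2 - x $ 3 * y $ 3"

definition lnorm :: "real^3 \<Rightarrow> real" where
  "lnorm x = sqrt \<bar>lor x x\<bar>"

definition spacelike_vec :: "real^3 \<Rightarrow> bool" where
  "spacelike_vec x \<longleftrightarrow> lor x x > 0 \<or> x = 0"

definition timelike_vec :: "real^3 \<Rightarrow> bool" where
  "timelike_vec x \<longleftrightarrow> lor x x < 0"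

text \<open>
  The sign convention matters: \<open>lor u (lcross x y)\<close> is minus the determinant
  of the rows \<open>u, x, y\<close>.
\<close>

definition lcross :: "real^3 \<Rightarrow> real^3 \<Rightarrow> real^3" where
  "lcross x y = vector [x $ 3 * y $ 2 - x $ 2 * y $ 3,
                        x $ 1 * y $ 3 - x $ 3 * y $ 1,
                        x $ 1 * y $ 2 - x $ 2 * y $ 1]"

definition vderiv :: "(real \<Rightarrow> 'a::real_normed_vector) \<Rightarrow> real \<Rightarrow> 'a" where
  "vderiv f t = vector_derivative f (at t)"

text \<open>
  Smoothness means of class \<open>C\<^sup>\<infinity>\<close>: every iterated derivative exists and is
  differentiable. As \<^const>\<open>vderiv\<close> is a two-sided derivative, this is only
  meaningful for open \<open>I\<close>.
\<close>

definition smooth_on :: "real set \<Rightarrow> (real \<Rightarrow> 'a::real_normed_vector) \<Rightarrow> bool" where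
  "smooth_on I f \<longleftrightarrow> (\<forall>k. (vderiv ^^ k) f differentiable_on I)"

definition spacelike_curve :: "real set \<Rightarrow> (real \<Rightarrow> real^3) \<Rightarrow> bool" where
  "spacelike_curve I \<alpha> \<longleftrightarrow> (\<forall>u\<in>I. spacelike_vec (vderiv \<alpha> u))"

definition ruled_param :: "(real \<Rightarrow> real^3) \<Rightarrow> (real \<Rightarrow> real^3) \<Rightarrow> real \<Rightarrow> real \<Rightarrow> real^3" where
  "ruled_param \<alpha> \<gamma> u v = \<alpha> u + v *\<^sub>R \<gamma> u"

definition ruled_surface :: "real set \<Rightarrow> (real \<Rightarrow> real^3) \<Rightarrow> (real \<Rightarrow> real^3) \<Rightarrow> bool" where
  "ruled_surface I \<alpha> \<gamma> \<longleftrightarrow> smooth_on I \<alpha> \<and> smooth_on I \<gamma> \<and> (\<forall>u\<in>I. vderiv \<alpha> u \<noteq> 0)"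

definition non_cylindrical :: "real set \<Rightarrow> (real \<Rightarrow> real^3) \<Rightarrow> bool" where
  "non_cylindrical I \<gamma> \<longleftrightarrow> (\<forall>u\<in>I. lcross (\<gamma> u) (vderiv \<gamma> u) \<noteq> 0)"

definition striction_curve :: "(real \<Rightarrow> real^3) \<Rightarrow> (real \<Rightarrow> real^3) \<Rightarrow> real \<Rightarrow> real^3" where
  "striction_curve \<alpha> \<gamma> u =
     \<alpha> u - (lor (vderiv \<alpha> u) (vderiv \<gamma> u) / lor (vderiv \<gamma> u) (vderiv \<gamma> u)) *\<^sub>R \<gamma> u"

text \<open>
  The normalized parametrization: base curve \<open>\<beta>\<close> and director \<open>e\<close> with \<open>e\<close> a unit
  field and \<open>\<beta>\<close> the striction curve of the very surface that it parametrizes.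
\<close>

definition striction_form :: "real set \<Rightarrow> (real \<Rightarrow> real^3) \<Rightarrow> (real \<Rightarrow> real^3) \<Rightarrow> bool" where
  "striction_form I \<beta> e \<longleftrightarrow>
     ruled_surface I \<beta> e \<and> non_cylindrical I e \<and>
     (\<forall>u\<in>I. lnorm (e u) = 1 \<and> lor (vderiv \<beta> u) (vderiv e u) = 0 \<and> \<beta> u = striction_curve \<beta> e u)"

definition central_normal :: "(real \<Rightarrow> real^3) \<Rightarrow> real \<Rightarrow> real^3" where
  "central_normal e u = vderiv e u /\<^sub>R lnorm (vderiv e u)"

definition central_tangent :: "(real \<Rightarrow> real^3) \<Rightarrow> real \<Rightarrow> real^3" where
  "central_tangent e u = lcross (e u) (vderiv e u) /\<^sub>R lnorm (lcross (e u) (vderiv e u))"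

definition frame_space_time_space :: "real^3 \<Rightarrow> real^3 \<Rightarrow> real^3 \<Rightarrow> bool" where
  "frame_space_time_space a b c \<longleftrightarrow>
     lor a a = 1 \<and> lor b b = -1 \<and> lor c c = 1 \<and>
     lor a b = 0 \<and> lor a c = 0 \<and> lor b c = 0"

definition distribution_parameter :: "(real \<Rightarrow> real^3) \<Rightarrow> (real \<Rightarrow> real^3) \<Rightarrow> real \<Rightarrow> real" where
  "distribution_parameter \<beta> e u =
     det (vector [vderiv \<beta> u, e u, vderiv e u] :: real^3^3) / lor (vderiv e u) (vderiv e u)"

definition du :: "(real \<Rightarrow> real \<Rightarrow> real^3) \<Rightarrow> real \<Rightarrow> real \<Rightarrow> real^3" where
  "du X u v = vderiv (\<lambda>s. X s v) u"

definition dv :: "(real \<Rightarrow> real \<Rightarrow> real^3) \<Rightarrow> real \<Rightarrow> real \<Rightarrow> real^3" where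
  "dv X u v = vderiv (\<lambda>t. X u t) v"

definition unit_normal :: "(real \<Rightarrow> real \<Rightarrow> real^3) \<Rightarrow> real \<Rightarrow> real \<Rightarrow> real^3" where
  "unit_normal X u v =
     lcross (du X u v) (dv X u v) /\<^sub>R lnorm (lcross (du X u v) (dv X u v))"

definition spacelike_surface_at :: "(real \<Rightarrow> real \<Rightarrow> real^3) \<Rightarrow> real \<Rightarrow> real \<Rightarrow> bool" where
  "spacelike_surface_at X u v \<longleftrightarrow> timelike_vec (unit_normal X u v)"

text \<open>
  In this sign convention, \<open>M\<close> is the \<open>vv\<close> coefficient and \<open>N\<close> the mixed one.
\<close>

definition gauss_curvature :: "(real \<Rightarrow> real \<Rightarrow> real^3) \<Rightarrow> real \<Rightarrow> real \<Rightarrow> real" where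
  "gauss_curvature X u v =
     (let E = lor (du X u v) (du X u v);
          F = lor (du X u v) (dv X u v);
          G = lor (dv X u v) (dv X u v);
          L = lor (du (du X) u v) (unit_normal X u v);
          N = lor (dv (du X) u v) (unit_normal X u v);
          M = lor (dv (dv X) u v) (unit_normal X u v)
      in (L * M - N\<^sup>2) / (E * G - F\<^sup>2))"

end

theory Submission
  imports Defs
begin

text \<open>
  On a ruled surface \<open>X(u,v) = \<beta>(u) + v e(u)\<close> the second fundamental form has no \<open>vv\<close> entry,
  because \<open>X\<close> is affine in \<open>v\<close>. Hence \<open>K = - N\<^sup>2 / D\<close> with \<open>D = E G - F\<^sup>2\<close>, and second
  derivatives in \<open>u\<close> do not enter. Two identities for the Lorentzian product express
  everything else in first-order data. The scalar triple product gives
  \<open>\<langle>e', (\<beta>' + v e') \<and> e\<rangle> = - det(\<beta>', e, e')\<close>, where \<open>v\<close> has disappeared, and the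
  Lagrange identity gives \<open>\<langle>X\<^sub>u \<and> X\<^sub>v, X\<^sub>u \<and> X\<^sub>v\<rangle> = - D\<close>. So the surface is spacelike
  exactly where \<open>D > 0\<close>, and \<open>K = - det(\<beta>', e, e')\<^sup>2 / (D \<bar>D\<bar>)\<close> for every ruled surface
  (\<open>spacelike_ruled_iff\<close>, \<open>gauss_curvature_ruled\<close>).

  With \<open>q = \<parallel>e'\<parallel>\<close> and \<open>\<langle>e',e'\<rangle> = - q\<^sup>2\<close>, the adapted frame yields
  \<open>\<parallel>e \<and> e'\<parallel> = q\<close>, hence \<open>P = sin \<sigma> / q\<close> and
  \<open>D = 1 - v\<^sup>2 q\<^sup>2 - cos\<^sup>2 \<sigma> = q\<^sup>2 (P\<^sup>2 - v\<^sup>2)\<close>, while \<open>det(\<beta>', e, e') = - P q\<^sup>2\<close> by the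
  definition of \<open>P\<close>. Substituting, all powers of \<open>q\<close> cancel.
\<close>

section \<open>Algebra of the Lorentz form\<close>

lemma lor_commute: "lor x y = lor y x"
  by (simp add: lor_def)

lemma lor_add_left: "lor (x + y) z = lor x z + lor y z"
  by (simp add: lor_def algebra_simps)

lemma lor_add_right: "lor z (x + y) = lor z x + lor z y"
  by (simp add: lor_def algebra_simps)

lemma lor_scaleR_left: "lor (c *\<^sub>R x) y = c * lor x y"
  by (simp add: lor_def algebra_simps)

lemma lor_scaleR_right: "lor x (c *\<^sub>R y) = c * lor x y"
  by (simp add: lor_def algebra_simps)

lemma lor_zero_left: "lor 0 x = 0"
  by (simp add: lor_def)

lemmas lor_linear = lor_add_left lor_add_right lor_scaleR_left lor_scaleR_right

lemma lnorm_power2: "(lnorm x)\<^sup>2 = \<bar>lor x x\<bar>"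
  by (simp add: lnorm_def)

definition lor_gram :: "real^3 \<Rightarrow> real^3 \<Rightarrow> real" where
  "lor_gram x y = lor x x * lor y y - (lor x y)\<^sup>2"

text \<open>
  The Lagrange identity. Compared with the Euclidean one the sign is reversed, since the
  form has signature \<open>(+,+,-)\<close>: the product of two vectors that span a positive definite
  plane is timelike.
\<close>

lemma lor_lcross_self: "lor (lcross x y) (lcross x y) = - lor_gram x y"
  by (simp add: lor_gram_def lor_def lcross_def algebra_simps power2_eq_square)

lemma det_rows_eq_lor_lcross: "det (vector [x, y, z] :: real^3^3) = - lor x (lcross y z)"
  by (simp add: lor_def lcross_def det_3 algebra_simps)

text \<open>
  The triple product is alternating, so adding a multiple of \<open>z\<close> to another factor changes
  nothing. For \<open>z = e'\<close> this removes \<open>v\<close> from the mixed coefficient \<open>N\<close>, up to normalization.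
\<close>

lemma lor_lcross_shift: "lor z (lcross (x + v *\<^sub>R z) y) = lor x (lcross y z)"
  by (simp add: lor_def lcross_def algebra_simps)

section \<open>Ruled surfaces\<close>

lemma smooth_on_differentiable_at:
  assumes "smooth_on I f" "open I" "u \<in> I"
  shows "f differentiable at u"
proof -
  have "(vderiv ^^ 0) f differentiable_on I"
    using assms(1) unfolding smooth_on_def by blast
  then show ?thesis
    using assms(2,3) by (simp add: differentiable_on_eq_differentiable_at)
qed

lemma du_ruled_param:
  assumes "\<beta> differentiable at u" "e differentiable at u"
  shows "du (ruled_param \<beta> e) u v = vderiv \<beta> u + v *\<^sub>R vderiv e u"
proof -
  have "((\<lambda>s. \<beta> s + v *\<^sub>R e s) has_vector_derivative vderiv \<beta> u + v *\<^sub>R vderiv e u) (at u)"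
    using assms unfolding vderiv_def vector_derivative_works
    by (auto intro!: derivative_eq_intros)
  then show ?thesis
    by (simp add: du_def ruled_param_def vderiv_def[of "\<lambda>s. _ s + _ s"] vector_derivative_at)
qed

lemma vderiv_affine: "vderiv (\<lambda>t. a + t *\<^sub>R b) t = b"
  unfolding vderiv_def
  by (rule vector_derivative_at) (auto intro!: derivative_eq_intros)

lemma dv_ruled_param: "dv (ruled_param \<beta> e) u v = e u"
  by (simp add: dv_def ruled_param_def vderiv_affine)

lemma dv_dv_ruled_param: "dv (dv (ruled_param \<beta> e)) u v = 0"
  by (simp add: dv_def[of "dv _"] dv_ruled_param vderiv_def)

lemma dv_du_ruled_param:
  assumes "\<beta> differentiable at u" "e differentiable at u"
  shows "dv (du (ruled_param \<beta> e)) u v = vderiv e u"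
  by (simp add: dv_def du_ruled_param[OF assms] vderiv_affine)

text \<open>
  Where \<open>X\<^sub>u \<and> X\<^sub>v\<close> is null, its norm vanishes and \<open>unit_normal\<close> takes the value \<open>0\<close>. This is
  not a timelike vector, so the equivalence below includes degenerate points.
\<close>

lemma lor_unit_normal_self:
  "lor (unit_normal X u v) (unit_normal X u v) = - sgn (lor_gram (du X u v) (dv X u v))"
proof -
  define w where "w = lcross (du X u v) (dv X u v)"
  have "lor (unit_normal X u v) (unit_normal X u v) = lor w w / (lnorm w)\<^sup>2"
    by (simp add: unit_normal_def w_def lor_linear power2_eq_square field_simps)
  also have "\<dots> = sgn (lor w w)"
    by (simp add: lnorm_power2 sgn_if)
  finally show ?thesis
    by (simp add: w_def lor_lcross_self sgn_minus)
qed

lemma spacelike_ruled_iff: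
  assumes "\<beta> differentiable at u" "e differentiable at u"
  shows "spacelike_surface_at (ruled_param \<beta> e) u v \<longleftrightarrow>
           lor_gram (vderiv \<beta> u + v *\<^sub>R vderiv e u) (e u) > 0"
  by (simp add: spacelike_surface_at_def timelike_vec_def lor_unit_normal_self
      du_ruled_param[OF assms] dv_ruled_param)

text \<open>
  The absolute value is the squared norm of \<open>X\<^sub>u \<and> X\<^sub>v\<close>, which normalizes the normal in
  \<open>N\<^sup>2\<close>; the other factor is \<open>E G - F\<^sup>2\<close> itself.
\<close>

lemma gauss_curvature_ruled:
  assumes "\<beta> differentiable at u" "e differentiable at u"
  defines "D \<equiv> \<lambda>v. lor_gram (vderiv \<beta> u + v *\<^sub>R vderiv e u) (e u)"
  shows "gauss_curvature (ruled_param \<beta> e) u v =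
           - ((det (vector [vderiv \<beta> u, e u, vderiv e u] :: real^3^3))\<^sup>2 / (\<bar>D v\<bar> * D v))"
proof -
  define X where "X = ruled_param \<beta> e"
  define w where "w = lcross (vderiv \<beta> u + v *\<^sub>R vderiv e u) (e u)"
  have normal: "unit_normal X u v = w /\<^sub>R lnorm w"
    by (simp add: unit_normal_def X_def w_def du_ruled_param[OF assms(1,2)] dv_ruled_param)
  have "lor (vderiv e u) w = - det (vector [vderiv \<beta> u, e u, vderiv e u] :: real^3^3)"
    by (simp add: w_def lor_lcross_shift det_rows_eq_lor_lcross)
  then have "(lor (vderiv e u) (unit_normal X u v))\<^sup>2 =
      (det (vector [vderiv \<beta> u, e u, vderiv e u] :: real^3^3))\<^sup>2 / (lnorm w)\<^sup>2"
    by (simp add: normal lor_scaleR_right power_mult_distrib power_divide divide_inverse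
        power_inverse)
  also have "(lnorm w)\<^sup>2 = \<bar>D v\<bar>"
    by (simp add: lnorm_power2 w_def lor_lcross_self D_def)
  finally have N: "(lor (vderiv e u) (unit_normal X u v))\<^sup>2 =
      (det (vector [vderiv \<beta> u, e u, vderiv e u] :: real^3^3))\<^sup>2 / \<bar>D v\<bar>" .
  have "gauss_curvature X u v = - (lor (vderiv e u) (unit_normal X u v))\<^sup>2 / D v"
    by (simp add: gauss_curvature_def X_def dv_dv_ruled_param lor_zero_left D_def lor_gram_def
        dv_du_ruled_param[OF assms(1,2)] du_ruled_param[OF assms(1,2)] dv_ruled_param)
  then show ?thesis
    using N by (simp add: X_def)
qed

section \<open>The adapted frame\<close>

text \<open>
  These relations extract from the frame what the curvature needs. Here \<open>x\<close> stands for \<open>e'\<close>;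
  \<open>\<parallel>e \<and> x\<parallel> = \<parallel>x\<parallel>\<close> is the Lagrange identity for the orthogonal pair \<open>e, x\<close> with
  \<open>e\<close> of unit length.
\<close>

lemma frame_relations:
  fixes e x :: "real^3"
  defines "n \<equiv> x /\<^sub>R lnorm x" and "\<xi> \<equiv> lcross e x /\<^sub>R lnorm (lcross e x)"
  assumes "frame_space_time_space e n \<xi>"
  shows "lnorm x > 0" "lor x x = - (lnorm x)\<^sup>2" "lor e x = 0" "lor \<xi> x = 0"
    and "lcross e x = lnorm x *\<^sub>R \<xi>"
proof -
  have frame: "lor e e = 1" "lor n n = -1" "lor e n = 0" "lor \<xi> n = 0"
    using assms(3) by (auto simp: frame_space_time_space_def lor_commute)
  have "lnorm x \<noteq> 0"
    using frame(2) by (auto simp: n_def lor_zero_left)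
  then show pos: "lnorm x > 0"
    by (simp add: lnorm_def)
  then have x: "x = lnorm x *\<^sub>R n"
    by (simp add: n_def)
  show xx: "lor x x = - (lnorm x)\<^sup>2"
    by (subst (1 2) x) (simp only: lor_linear frame(2), simp add: power2_eq_square)
  show ex: "lor e x = 0" and "lor \<xi> x = 0"
    by (subst x; simp only: lor_linear frame mult_zero_right)+
  have "lor (lcross e x) (lcross e x) = (lnorm x)\<^sup>2"
    by (simp add: lor_lcross_self lor_gram_def frame(1) xx ex)
  then have "lnorm (lcross e x) = lnorm x"
    using pos by (simp add: lnorm_def[of "lcross e x"])
  then show "lcross e x = lnorm x *\<^sub>R \<xi>"
    using pos by (simp add: \<xi>_def)
qed

theorem theorem4p1:
  fixes I :: "real set" and \<beta> e :: "real \<Rightarrow> real^3" and \<sigma> :: "real \<Rightarrow> real"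
  assumes "open I" and "is_interval I" and "I \<noteq> {}"
    and "striction_form I \<beta> e"
    and "spacelike_curve I \<beta>"
    and "\<And>u. u \<in> I \<Longrightarrow> frame_space_time_space (e u) (central_normal e u) (central_tangent e u)"
    and "smooth_on I \<sigma>"
    and "\<And>u. u \<in> I \<Longrightarrow>
           vderiv \<beta> u = cos (\<sigma> u) *\<^sub>R e u + sin (\<sigma> u) *\<^sub>R central_tangent e u"
  defines "P \<equiv> distribution_parameter \<beta> e"
    and "K \<equiv> gauss_curvature (ruled_param \<beta> e)"
  shows "\<forall>u\<in>I. \<forall>v.
           (spacelike_surface_at (ruled_param \<beta> e) u v \<longleftrightarrow> \<bar>v\<bar> < \<bar>P u\<bar>) \<and>
           (\<bar>v\<bar> < \<bar>P u\<bar> \<longrightarrow> K u v = - ((P u)\<^sup>2 / ((P u)\<^sup>2 - v\<^sup>2)\<^sup>2))"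
proof (intro ballI allI)
  fix u v
  assume u: "u \<in> I"
  define b x \<xi> where "b = vderiv \<beta> u" and "x = vderiv e u" and "\<xi> = central_tangent e u"
  define q d where "q = lnorm x" and "d = det (vector [b, e u, x] :: real^3^3)"
  have frame: "frame_space_time_space (e u) (x /\<^sub>R lnorm x) (lcross (e u) x /\<^sub>R lnorm (lcross (e u) x))"
    using assms(6)[OF u] by (simp add: central_normal_def central_tangent_def x_def)
  have \<xi>: "lcross (e u) x /\<^sub>R lnorm (lcross (e u) x) = \<xi>"
    by (simp add: \<xi>_def central_tangent_def x_def)
  note rel = frame_relations[OF frame, unfolded \<xi>, folded q_def]
  have unit: "lor (e u) (e u) = 1" "lor \<xi> \<xi> = 1" "lor (e u) \<xi> = 0"
    using frame by (simp_all add: frame_space_time_space_def \<xi>)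
  have b: "b = cos (\<sigma> u) *\<^sub>R e u + sin (\<sigma> u) *\<^sub>R \<xi>"
    using assms(8)[OF u] by (simp add: b_def \<xi>_def)
  have q: "q > 0" by (rule rel(1))
  have "lor b \<xi> = sin (\<sigma> u)"
    by (simp add: b lor_linear unit)
  then have d: "d = - (q * sin (\<sigma> u))"
    by (simp add: d_def det_rows_eq_lor_lcross rel(5) lor_scaleR_right)
  have dP: "d = - (P u * q\<^sup>2)"
    using q by (simp add: P_def distribution_parameter_def rel(2) flip: b_def x_def d_def)
  have sin: "sin (\<sigma> u) = P u * q"
    using d dP q by (simp add: power2_eq_square)
  have "lor b b = 1" "lor b (e u) = cos (\<sigma> u)" "lor b x = 0"
    by (simp_all add: b lor_linear unit rel(3,4) lor_commute[of \<xi> "e u"] flip: power2_eq_square)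
  then have "lor_gram (b + v *\<^sub>R x) (e u) = 1 - v\<^sup>2 * q\<^sup>2 - (cos (\<sigma> u))\<^sup>2"
    by (simp add: lor_gram_def lor_linear unit rel(2,3) lor_commute[of x b]
        lor_commute[of x "e u"] power2_eq_square)
  also have "\<dots> = (sin (\<sigma> u))\<^sup>2 - v\<^sup>2 * q\<^sup>2"
    by (simp add: sin_squared_eq)
  finally have D: "lor_gram (b + v *\<^sub>R x) (e u) = q\<^sup>2 * ((P u)\<^sup>2 - v\<^sup>2)"
    by (simp add: sin power_mult_distrib algebra_simps)
  have diff: "\<beta> differentiable at u" "e differentiable at u"
    using assms(1,4) u
    by (auto simp: striction_form_def ruled_surface_def intro: smooth_on_differentiable_at)
  have sign: "(P u)\<^sup>2 - v\<^sup>2 > 0 \<longleftrightarrow> \<bar>v\<bar> < \<bar>P u\<bar>"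
    using abs_le_square_iff[of "P u" v] by auto
  have "spacelike_surface_at (ruled_param \<beta> e) u v \<longleftrightarrow> \<bar>v\<bar> < \<bar>P u\<bar>"
    using q sign
    by (simp add: spacelike_ruled_iff[OF diff] zero_less_mult_iff D flip: b_def x_def)
  moreover have "K u v = - ((P u)\<^sup>2 / ((P u)\<^sup>2 - v\<^sup>2)\<^sup>2)" if "\<bar>v\<bar> < \<bar>P u\<bar>"
  proof -
    have pos: "(P u)\<^sup>2 - v\<^sup>2 > 0"
      using that sign by simp
    have "K u v = - (d\<^sup>2 / (q\<^sup>2 * ((P u)\<^sup>2 - v\<^sup>2))\<^sup>2)"
      using pos
      by (simp add: K_def gauss_curvature_ruled[OF diff] D abs_mult power2_eq_square[of "q\<^sup>2 * _"]
          flip: b_def x_def d_def)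
    also have "\<dots> = - ((P u)\<^sup>2 / ((P u)\<^sup>2 - v\<^sup>2)\<^sup>2)"
      using q by (simp add: dP power_mult_distrib)
    finally show ?thesis .
  qed
  ultimately show "(spacelike_surface_at (ruled_param \<beta> e) u v \<longleftrightarrow> \<bar>v\<bar> < \<bar>P u\<bar>) \<and>
      (\<bar>v\<bar> < \<bar>P u\<bar> \<longrightarrow> K u v = - ((P u)\<^sup>2 / ((P u)\<^sup>2 - v\<^sup>2)\<^sup>2))"
    by blast
qed

end
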